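(* Let $\{Z_n\}_{n\ge 0}$ be a branching process in an i.i.d. random environment, with $X=\ln m_0$, $\mu=\mathbb{E}X$, $\sigma^2=\mathbb{E}(X-\mu)^2$ as in the context, such that almost surely every individual has at least one child and $0<\sigma^2<\infty$. Assume that there exist real constants $H_1<H_2$ such that $H_1\le X-\mu\le H_2$ almost surely. Let $n_0\ge0$ and $n\ge1$ be integers, let $$\delta_n\in\left[2\exp\left\{-\tfrac n2(H_2-H_1)^2\right\},\,1\right]\qquad\text{and}\qquad \Delta_n=(H_2-H_1)\sqrt{\tfrac2n\ln(2/\delta_n)}.$$ Then $[A_n,+\infty)$, with $$A_n=\frac1n\ln\left(\frac{Z_{n_0+n}}{Z_{n_0}}\right)-\Delta_n,$$ is a $1-\delta_n$ confidence interval for $\mu$, i.e. $\mathbb{P}(\mu\ge A_n)\ge1-\delta_n$.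
   Context: Branching process in a random environment: $\xi=(\xi_0,\xi_1,\dots)$ is a sequence of i.i.d. random variables (the environment). Each value of $\xi_n$ determines a probability distribution $p(\xi_n)=\{p_n(i): i\in\mathbb{N}\}$ on $\mathbb{N}=\{0,1,2,\dots\}$ (the offspring law at generation $n$). The process is defined by $Z_0=1$ and $Z_{n+1}=\sum_{i=1}^{Z_n}N_{n,i}$ for $n\ge 0$, where, conditionally on $\xi$, the variables $\{N_{n,i}: n\ge0,i\ge1\}$ are independent and, for each $n$, the $N_{n,i}$ $(i\ge1)$ have common law $p(\xi_n)$. $\mathbb{P}$ is the total (annealed) law, i.e. $\mathbb{P}(dx,d\xi)=\mathbb{P}_\xi(dx)\tau(d\xi)$ with $\mathbb{P}_\xi$ the conditional law given $\xi$ and $\tau$ the law of $\xi$; $\mathbb{E}$ is the corresponding expectation. Put $m_n=\sum_{i\ge0} i\,p_n(i)$ (conditional mean offspring number at generation $n$ given $\xi$), $X=\ln m_0$, $\mu=\mathbb{E}X$, $\sigma^2=\mathbb{E}(X-\mu)^2$, $\sigma>0$. Standing assumption: $p_0(0)=0$ almost surely (the probability of having no children is zero) and $0<\sigma^2<\infty$; hence $Z_n\ge1$ a.s. for all $n$. *)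

theory Defs
  imports "HOL-Probability.Probability"
begin

text \<open>Conditional probability of an event given a sub-sigma-algebra (a version, defined up to
  null sets).\<close>

definition cprob :: "'a measure \<Rightarrow> 'a measure \<Rightarrow> 'a set \<Rightarrow> 'a \<Rightarrow> real" where
  "cprob M F A = real_cond_exp M F (indicator A)"

definition cond_indep_vars ::
  "'a measure \<Rightarrow> 'a measure \<Rightarrow> 'b measure \<Rightarrow> ('i \<Rightarrow> 'a \<Rightarrow> 'b) \<Rightarrow> 'i set \<Rightarrow> bool" where
  "cond_indep_vars M F S Y I \<longleftrightarrow>
     (\<forall>i\<in>I. Y i \<in> M \<rightarrow>\<^sub>M S) \<and>
     (\<forall>J B. finite J \<longrightarrow> J \<noteq> {} \<longrightarrow> J \<subseteq> I \<longrightarrow> (\<forall>j\<in>J. B j \<in> sets S) \<longrightarrow>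
        (AE \<omega> in M. cprob M F {\<omega>'\<in>space M. \<forall>j\<in>J. Y j \<omega>' \<in> B j} \<omega>
                    = (\<Prod>j\<in>J. cprob M F {\<omega>'\<in>space M. Y j \<omega>' \<in> B j} \<omega>)))"

text \<open>The sigma-algebra on \<open>\<Omega>\<close> generated by the whole environment sequence.\<close>

definition env_sigma :: "'a measure \<Rightarrow> 'e measure \<Rightarrow> (nat \<Rightarrow> 'a \<Rightarrow> 'e) \<Rightarrow> 'a measure" where
  "env_sigma M E \<xi> =
     vimage_algebra (space M) (\<lambda>\<omega>. \<lambda>n\<in>UNIV. \<xi> n \<omega>) (\<Pi>\<^sub>M n\<in>(UNIV :: nat set). E)"

text \<open>\<open>M\<close> carries the annealed law. The environment variables \<open>\<xi> n\<close> take values in an arbitrary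
  measurable space \<open>E\<close>, and \<open>p e\<close> is the offspring law attached to the environment state \<open>e\<close>.
  The offspring variables \<open>N n i\<close> are only constrained (and only used) for \<open>i \<ge> 1\<close>.\<close>

locale branching_random_env = prob_space M
  for M :: "'a measure" +
  fixes E :: "'e measure"
    and \<xi> :: "nat \<Rightarrow> 'a \<Rightarrow> 'e"
    and p :: "'e \<Rightarrow> nat pmf"
    and N :: "nat \<Rightarrow> nat \<Rightarrow> 'a \<Rightarrow> nat"
  assumes env_indep: "indep_vars (\<lambda>_. E) \<xi> UNIV"
    and env_ident: "\<And>n. distr M E (\<xi> n) = distr M E (\<xi> 0)"
    and law_measurable: "(\<lambda>e. measure_pmf (p e)) \<in> E \<rightarrow>\<^sub>M prob_algebra (count_space UNIV)"
    and offspring_cond_indep: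
      "cond_indep_vars M (env_sigma M E \<xi>) (count_space UNIV)
         (\<lambda>(n, i). N n i) {(n, i). 1 \<le> i}"
    and offspring_cond_law:
      "\<And>n i B. 1 \<le> i \<Longrightarrow>
         AE \<omega> in M. cprob M (env_sigma M E \<xi>) {\<omega>'\<in>space M. N n i \<omega>' \<in> B} \<omega>
                     = measure_pmf.prob (p (\<xi> n \<omega>)) B"

primrec population :: "(nat \<Rightarrow> nat \<Rightarrow> 'a \<Rightarrow> nat) \<Rightarrow> nat \<Rightarrow> 'a \<Rightarrow> nat" where
  "population N 0 \<omega> = 1"
| "population N (Suc n) \<omega> = (\<Sum>i = 1..population N n \<omega>. N n i \<omega>)"

text \<open>Mean of an offspring law, as an extended real so that an infinite mean is not collapsed
  to 0.\<close>

definition law_mean :: "nat pmf \<Rightarrow> ennreal" where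
  "law_mean q = (\<Sum>i. of_nat i * ennreal (pmf q i))"

text \<open>The logarithm of the conditional mean offspring number at generation \<open>n\<close>. It is meaningful
  only where \<open>0 < m\<^sub>n < \<infinity>\<close>; \<open>standing_assumption\<close> makes this hold almost surely.\<close>

definition log_mean :: "(nat \<Rightarrow> 'a \<Rightarrow> 'e) \<Rightarrow> ('e \<Rightarrow> nat pmf) \<Rightarrow> nat \<Rightarrow> 'a \<Rightarrow> real" where
  "log_mean \<xi> p n \<omega> = ln (enn2real (law_mean (p (\<xi> n \<omega>))))"

definition env_mu :: "'a measure \<Rightarrow> (nat \<Rightarrow> 'a \<Rightarrow> 'e) \<Rightarrow> ('e \<Rightarrow> nat pmf) \<Rightarrow> real" where
  "env_mu M \<xi> p = (\<integral>\<omega>. log_mean \<xi> p 0 \<omega> \<partial>M)"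

definition env_var :: "'a measure \<Rightarrow> (nat \<Rightarrow> 'a \<Rightarrow> 'e) \<Rightarrow> ('e \<Rightarrow> nat pmf) \<Rightarrow> real" where
  "env_var M \<xi> p = (\<integral>\<omega>. (log_mean \<xi> p 0 \<omega> - env_mu M \<xi> p)\<^sup>2 \<partial>M)"

text \<open>Almost surely no individual is childless, and \<open>0 < \<sigma>\<^sup>2 < \<infinity>\<close>. Finiteness of \<open>\<sigma>\<^sup>2\<close> is spelled
  out as: \<open>m\<^sub>0\<close> is almost surely finite (so \<open>X = ln m\<^sub>0\<close> is real valued), \<open>X\<close> is integrable (so \<open>\<mu>\<close>
  exists), and \<open>(X - \<mu>)\<^sup>2\<close> is integrable.\<close>

definition standing_assumption ::
  "'a measure \<Rightarrow> (nat \<Rightarrow> 'a \<Rightarrow> 'e) \<Rightarrow> ('e \<Rightarrow> nat pmf) \<Rightarrow> bool" where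
  "standing_assumption M \<xi> p \<longleftrightarrow>
     (AE \<omega> in M. pmf (p (\<xi> 0 \<omega>)) 0 = 0) \<and>
     (AE \<omega> in M. law_mean (p (\<xi> 0 \<omega>)) < \<infinity>) \<and>
     integrable M (log_mean \<xi> p 0) \<and>
     integrable M (\<lambda>\<omega>. (log_mean \<xi> p 0 \<omega> - env_mu M \<xi> p)\<^sup>2) \<and>
     0 < env_var M \<xi> p"

end

theory Submission
  imports Defs
begin

text \<open>Write \<open>Z\<^sub>n\<^sub>0\<^sub>+\<^sub>n / Z\<^sub>n\<^sub>0 = m\<^sub>n\<^sub>0 \<cdots> m\<^sub>n\<^sub>0\<^sub>+\<^sub>n\<^sub>-\<^sub>1 \<cdot> W\<close>. If \<open>\<mu> < A\<^sub>n\<close>, then one of the two factors is large: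
  either \<open>\<Sum>(X\<^sub>k - \<mu>) \<ge> n \<Delta>\<^sub>n / 2\<close>, which has probability at most \<open>\<delta>\<^sub>n / 2\<close> by Hoeffding's inequality, or
  \<open>ln W \<ge> n \<Delta>\<^sub>n / 2\<close>, which has probability at most \<open>\<delta>\<^sub>n / 2\<close> by Markov's inequality, because \<open>E W \<le> 1\<close>
  and because the lower bound on \<open>\<delta>\<^sub>n\<close> says exactly that \<open>n \<Delta>\<^sub>n / 2 \<ge> ln (2 / \<delta>\<^sub>n)\<close>.
  For \<open>E W \<le> 1\<close> one needs that the offspring of generation \<open>k\<close> are independent of the past given the
  environment. The family tree up to generation \<open>k\<close> takes countably many values, and each of its level
  sets is a finite-dimensional cylinder in the offspring variables, so the product formula for
  finitely many offspring variables suffices.\<close>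

section \<open>Integrating against conditional probabilities\<close>

text \<open>\<open>real_cond_exp\<close> is a difference of two truncated nonnegative conditional
  expectations. For an indicator the second one vanishes and the first is at most 1 almost surely,
  so the truncation by \<open>enn2real\<close> loses nothing.\<close>

lemma (in sigma_finite_subalgebra) ennreal_cprob:
  assumes A: "A \<in> sets M"
  shows "AE \<omega> in M. ennreal (cprob M F A \<omega>) = nn_cond_exp M F (indicator A) \<omega>"
proof -
  have [measurable]: "A \<in> sets M" by (rule A)
  have [simp]: "(\<lambda>x. ennreal (indicator A x)) = indicator A"
    "(\<lambda>x. ennreal (- indicator A x)) = (\<lambda>_. 0)"
    by (auto simp: indicator_def fun_eq_iff ennreal_neg)
  have "AE \<omega> in M. nn_cond_exp M F (indicator A) \<omega> \<le> nn_cond_exp M F (\<lambda>_. 1) \<omega>"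
    by (rule nn_cond_exp_mono) (auto simp: indicator_def)
  moreover have "AE \<omega> in M. 1 = nn_cond_exp M F (\<lambda>_. 1) \<omega>"
    using nn_cond_exp_F_meas[of "\<lambda>_. 1"] by simp
  moreover have "AE \<omega> in M. 0 = nn_cond_exp M F (\<lambda>_. 0) \<omega>"
    using nn_cond_exp_F_meas[of "\<lambda>_. 0"] by simp
  ultimately show ?thesis
  proof eventually_elim
    case (elim \<omega>)
    then have "nn_cond_exp M F (indicator A) \<omega> < top"
      using order_le_less_trans[OF _ ennreal_one_less_top] by metis
    with elim show ?case
      by (simp add: cprob_def real_cond_exp_def ennreal_enn2real)
  qed
qed

text \<open>The defining property of conditional expectation for nonnegative weights. It turns
  almost sure identities between conditional probabilities into identities between integrals, with
  no integrability to check.\<close>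

lemma (in sigma_finite_subalgebra) nn_integral_mult_cprob:
  assumes A: "A \<in> sets M" and g: "g \<in> borel_measurable F"
  shows "(\<integral>\<^sup>+\<omega>. g \<omega> * ennreal (cprob M F A \<omega>) \<partial>M) = (\<integral>\<^sup>+\<omega>. g \<omega> * indicator A \<omega> \<partial>M)"
proof -
  have "(\<integral>\<^sup>+\<omega>. g \<omega> * ennreal (cprob M F A \<omega>) \<partial>M) = (\<integral>\<^sup>+\<omega>. g \<omega> * nn_cond_exp M F (indicator A) \<omega> \<partial>M)"
    using ennreal_cprob[OF A] by (intro nn_integral_cong_AE) (auto elim: eventually_mono)
  also have "\<dots> = (\<integral>\<^sup>+\<omega>. g \<omega> * indicator A \<omega> \<partial>M)"
    using A g by (intro nn_cond_exp_intg) auto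
  finally show ?thesis .
qed

section \<open>Series over fixed indices and a lower bound for the offspring mean\<close>

lemma suminf_of_nat_indicator: "(\<Sum>c. of_nat c * indicator {c} n :: ennreal) = of_nat n"
  by (subst suminf_finite[of "{n}"]) auto

lemma suminf_indicator_atLeastAtMost:
  "(\<Sum>i. f i * indicator {1..n} i :: ennreal) = (\<Sum>i = 1..n. f i)"
  by (subst suminf_finite[of "{1..n}"]) auto

text \<open>All mass sits on \<open>i \<ge> 1\<close>, where \<open>i * pmf q i\<close> dominates
  \<open>pmf q i\<close>; the latter sum to 1.\<close>

lemma one_le_law_mean:
  assumes "pmf q 0 = 0"
  shows "1 \<le> law_mean q"
proof -
  have "1 = (\<integral>\<^sup>+i. ennreal (pmf q i) \<partial>count_space UNIV)"
    by (simp add: nn_integral_pmf)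
  also have "\<dots> = (\<Sum>i. ennreal (pmf q i))"
    by (rule nn_integral_count_space_nat)
  also have "\<dots> \<le> (\<Sum>i. of_nat i * ennreal (pmf q i))"
  proof (intro suminf_le)
    fix i show "ennreal (pmf q i) \<le> of_nat i * ennreal (pmf q i)"
    proof (cases i)
      case (Suc j)
      have "1 * ennreal (pmf q i) \<le> of_nat i * ennreal (pmf q i)"
        by (intro mult_right_mono) (auto simp: Suc)
      then show ?thesis by simp
    qed (use assms in simp)
  qed auto
  finally show ?thesis by (simp add: law_mean_def)
qed

section \<open>Genealogies and the offspring numbers that determine them\<close>

text \<open>Nested lists form a countable type, so measures on genealogies can be compared on singletons.\<close>

primrec genealogy :: "(nat \<Rightarrow> nat \<Rightarrow> 'a \<Rightarrow> nat) \<Rightarrow> nat \<Rightarrow> 'a \<Rightarrow> nat list list" where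
  "genealogy N 0 \<omega> = []"
| "genealogy N (Suc n) \<omega> = genealogy N n \<omega> @ [map (\<lambda>i. N n i \<omega>) [1..<Suc (population N n \<omega>)]]"

text \<open>The last row of a genealogy lists the offspring numbers of the last recorded generation,
  so its sum is the next population size; earlier sizes come from the induction hypothesis.\<close>

lemma population_eq_if_genealogy_eq:
  assumes "genealogy N n \<omega> = genealogy N n \<omega>'" "j \<le> n"
  shows "population N j \<omega> = population N j \<omega>'"
  using assms
proof (induction n arbitrary: j)
  case (Suc n)
  have eq: "genealogy N n \<omega> = genealogy N n \<omega>'"
    and last: "map (\<lambda>i. N n i \<omega>) [1..<Suc (population N n \<omega>)]
      = map (\<lambda>i. N n i \<omega>') [1..<Suc (population N n \<omega>')]"
    using Suc.prems(1) by auto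
  have *: "population N (Suc n) \<omega> = sum_list (map (\<lambda>i. N n i \<omega>) [1..<Suc (population N n \<omega>)])" for \<omega>
    by (simp only: population.simps interv_sum_list_conv_sum_set_nat atLeastLessThanSuc_atLeastAtMost set_upt)
  show ?case
  proof (cases "j = Suc n")
    case True
    then show ?thesis using * last by metis
  next
    case False
    then show ?thesis using Suc.IH[OF eq] Suc.prems(2) by simp
  qed
qed simp

text \<open>The index set depends on \<open>\<omega>'\<close> only, so for fixed
  \<open>\<omega>'\<close> the condition on \<open>\<omega>\<close> is a cylinder over finitely many
  offspring variables. This is possible because agreement in the earlier generations already forces
  equal population sizes.\<close>

lemma genealogy_eq_iff:
  "genealogy N n \<omega> = genealogy N n \<omega>' \<longleftrightarrow>
    (\<forall>(j, l)\<in>Sigma {..<n} (\<lambda>j. {1..population N j \<omega>'}). N j l \<omega> = N j l \<omega>')"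
proof (induction n)
  case (Suc n)
  have "genealogy N (Suc n) \<omega> = genealogy N (Suc n) \<omega>' \<longleftrightarrow>
    genealogy N n \<omega> = genealogy N n \<omega>' \<and>
    map (\<lambda>i. N n i \<omega>) [1..<Suc (population N n \<omega>)] = map (\<lambda>i. N n i \<omega>') [1..<Suc (population N n \<omega>')]"
    by simp
  also have "\<dots> \<longleftrightarrow> genealogy N n \<omega> = genealogy N n \<omega>' \<and>
    (\<forall>l\<in>{1..population N n \<omega>'}. N n l \<omega> = N n l \<omega>')"
    using population_eq_if_genealogy_eq[of N n \<omega> \<omega>' n]
    by (auto simp del: upt_Suc simp: map_eq_conv)
  also have "\<dots> \<longleftrightarrow> (\<forall>(j, l)\<in>Sigma {..<Suc n} (\<lambda>j. {1..population N j \<omega>'}). N j l \<omega> = N j l \<omega>')"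
    unfolding Suc.IH lessThan_Suc by auto
  finally show ?case .
qed simp

section \<open>Measurability, and the common law of the environment\<close>

context branching_random_env
begin

abbreviation env :: "'a measure" where "env \<equiv> env_sigma M E \<xi>"

abbreviation offspring_mean :: "nat \<Rightarrow> 'a \<Rightarrow> ennreal" where
  "offspring_mean k \<omega> \<equiv> law_mean (p (\<xi> k \<omega>))"

lemma measurable_environment [measurable]: "\<xi> k \<in> M \<rightarrow>\<^sub>M E"
  using env_indep by (auto simp: indep_vars_def)

lemma measurable_environment_env [measurable]: "\<xi> k \<in> env \<rightarrow>\<^sub>M E"
proof -
  have "(\<lambda>\<omega>. \<lambda>n\<in>UNIV. \<xi> n \<omega>) \<in> env \<rightarrow>\<^sub>M (\<Pi>\<^sub>M n\<in>(UNIV :: nat set). E)"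
    unfolding env_sigma_def
    by (intro measurable_vimage_algebra1 funcsetI)
       (simp add: space_PiM PiE_iff measurable_space[OF measurable_environment])
  from measurable_compose[OF this measurable_component_singleton[of k UNIV]]
  show ?thesis by simp
qed

lemma subalgebra_env: "subalgebra M env"
  unfolding subalgebra_def
proof
  show "space env = space M"
    by (simp add: env_sigma_def)
  have "(\<lambda>\<omega>. \<lambda>n\<in>UNIV. \<xi> n \<omega>) \<in> M \<rightarrow>\<^sub>M (\<Pi>\<^sub>M n\<in>(UNIV :: nat set). E)"
    by (rule measurable_restrict) (rule measurable_environment)
  then show "sets env \<subseteq> sets M"
    unfolding env_sigma_def by (intro sets_image_in_sets) auto
qed

sublocale env: finite_measure_subalgebra M env
  by unfold_locales (rule subalgebra_env)

lemma measurable_from_env: "f \<in> env \<rightarrow>\<^sub>M S \<Longrightarrow> f \<in> M \<rightarrow>\<^sub>M S"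
  by (rule measurable_from_subalg[OF subalgebra_env])

lemma measurable_law_pmf [measurable]: "(\<lambda>e. pmf (p e) i) \<in> borel_measurable E"
proof -
  have "(\<lambda>e. measure (measure_pmf (p e)) {i}) \<in> borel_measurable E"
    by (rule measurable_compose[OF measurable_prob_algebraD[OF law_measurable]
          measurable_measure_subprob_algebra]) simp
  then show ?thesis by (simp add: measure_pmf_single)
qed

lemma measurable_law_mean [measurable]: "(\<lambda>e. law_mean (p e)) \<in> borel_measurable E"
  unfolding law_mean_def by measurable

lemma measurable_offspring_mean_env: "offspring_mean k \<in> borel_measurable env"
  by (rule measurable_compose[OF measurable_environment_env measurable_law_mean])

lemma measurable_offspring:
  assumes "1 \<le> i"
  shows "N k i \<in> M \<rightarrow>\<^sub>M count_space UNIV"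
  using offspring_cond_indep assms unfolding cond_indep_vars_def by force

lemma measurable_population [measurable]: "population N k \<in> M \<rightarrow>\<^sub>M count_space UNIV"
proof (induction k)
  case (Suc k)
  have "(\<lambda>\<omega>. \<Sum>i = 1..z. N k i \<omega>) \<in> M \<rightarrow>\<^sub>M count_space UNIV" for z
  proof (induction z)
    case (Suc z)
    have "(\<lambda>\<omega>. s + N k (Suc z) \<omega>) \<in> M \<rightarrow>\<^sub>M count_space UNIV" for s
      by (rule measurable_compose[OF measurable_offspring]) auto
    from measurable_compose_countable[OF this Suc] show ?case by simp
  qed simp
  from measurable_compose_countable[OF this Suc] show ?case by simp
qed simp

text \<open>The range type is countable, so level sets suffice, and a nonempty level set is a finite
  cylinder.\<close>

lemma measurable_genealogy [measurable]: "genealogy N k \<in> M \<rightarrow>\<^sub>M count_space UNIV"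
proof -
  have "genealogy N k -` {t} \<inter> space M \<in> sets M" for t
  proof (cases "\<exists>\<omega>'\<in>space M. genealogy N k \<omega>' = t")
    case True
    then obtain \<omega>' where t: "t = genealogy N k \<omega>'" by blast
    have "genealogy N k -` {t} \<inter> space M =
      {\<omega>\<in>space M. \<forall>x\<in>Sigma {..<k} (\<lambda>j. {1..population N j \<omega>'}). N (fst x) (snd x) \<omega> = N (fst x) (snd x) \<omega>'}"
      unfolding t by (auto simp: genealogy_eq_iff)
    also have "\<dots> \<in> sets M"
    proof (intro sets.sets_Collect_finite_All)
      fix x assume "x \<in> Sigma {..<k} (\<lambda>j. {1..population N j \<omega>'})"
      then have "N (fst x) (snd x) \<in> M \<rightarrow>\<^sub>M count_space UNIV"
        by (intro measurable_offspring) auto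
      from measurable_sets[OF this, of "{N (fst x) (snd x) \<omega>'}"]
      show "{\<omega>\<in>space M. N (fst x) (snd x) \<omega> = N (fst x) (snd x) \<omega>'} \<in> sets M"
        by (simp add: vimage_def Int_def conj_commute)
    qed auto
    finally show ?thesis .
  next
    case False
    then have "genealogy N k -` {t} \<inter> space M = {}" by auto
    then show ?thesis by simp
  qed
  then show ?thesis
    by (subst measurable_count_space_eq2_countable) auto
qed

lemma AE_environment_shift:
  assumes P: "{e \<in> space E. P e} \<in> sets E" and 0: "AE \<omega> in M. P (\<xi> 0 \<omega>)"
  shows "AE \<omega> in M. P (\<xi> k \<omega>)"
proof -
  have "AE e in distr M E (\<xi> 0). P e"
    using 0 P by (subst AE_distr_iff) auto
  then have "AE e in distr M E (\<xi> k). P e"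
    by (simp only: env_ident[of k])
  then show ?thesis
    using P by (subst (asm) AE_distr_iff) auto
qed

section \<open>Independence of new offspring from the past, given the environment\<close>

text \<open>Adds the empty index set to the product formula; it occurs for generation 0, whose
  genealogy records no offspring.\<close>

lemma AE_cprob_cylinder:
  assumes J: "finite J" "J \<subseteq> {(n, i). 1 \<le> i}"
  shows "AE \<omega> in M. cprob M env {\<omega>'\<in>space M. \<forall>x\<in>J. N (fst x) (snd x) \<omega>' \<in> B x} \<omega>
    = (\<Prod>x\<in>J. cprob M env {\<omega>'\<in>space M. N (fst x) (snd x) \<omega>' \<in> B x} \<omega>)"
proof (cases "J = {}")
  case True
  have "AE \<omega> in M. real_cond_exp M env (\<lambda>_. 1) \<omega> = 1"
    by (rule env.real_cond_exp_F_meas) auto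
  moreover have "AE \<omega> in M. real_cond_exp M env (indicator (space M)) \<omega> = real_cond_exp M env (\<lambda>_. 1) \<omega>"
    by (rule env.real_cond_exp_cong) auto
  ultimately have "AE \<omega> in M. cprob M env (space M) \<omega> = 1"
    unfolding cprob_def by eventually_elim simp
  then show ?thesis
    using True by simp
next
  case False
  have "AE \<omega> in M. cprob M env {\<omega>'\<in>space M. \<forall>x\<in>J. (case x of (n, i) \<Rightarrow> N n i) \<omega>' \<in> B x} \<omega>
    = (\<Prod>x\<in>J. cprob M env {\<omega>'\<in>space M. (case x of (n, i) \<Rightarrow> N n i) \<omega>' \<in> B x} \<omega>)"
    using offspring_cond_indep J False unfolding cond_indep_vars_def by auto
  then show ?thesis by (simp add: case_prod_beta)
qed

lemma sets_cylinder:
  assumes J: "finite J" "J \<subseteq> {(n, i). 1 \<le> i}"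
  shows "{\<omega>\<in>space M. \<forall>x\<in>J. N (fst x) (snd x) \<omega> \<in> B x} \<in> sets M"
proof (intro sets.sets_Collect_finite_All)
  fix x assume "x \<in> J"
  then have "N (fst x) (snd x) \<in> M \<rightarrow>\<^sub>M count_space UNIV"
    using J by (intro measurable_offspring) auto
  from measurable_sets[OF this, of "B x"]
  show "{\<omega>\<in>space M. N (fst x) (snd x) \<omega> \<in> B x} \<in> sets M"
    by (simp add: vimage_def Int_def conj_commute)
qed (use J in auto)

text \<open>The product formulas over \<open>J\<close> and over \<open>insert (k, i) J\<close>
  differ by a single factor, the conditional probability of \<open>N k i = c\<close>, which the
  offspring law gives as \<open>pmf (p (\<xi> k \<omega>)) c\<close>. That factor is
  \<open>env\<close>-measurable and can join the weight \<open>g\<close>.\<close>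

lemma nn_integral_cylinder_eq:
  assumes J: "finite J" "J \<subseteq> {(n, i). 1 \<le> i}" and x: "(k, i) \<notin> J" "1 \<le> i"
    and g [measurable]: "g \<in> borel_measurable env"
    and D: "D = {\<omega>\<in>space M. \<forall>x\<in>J. N (fst x) (snd x) \<omega> \<in> B x}"
  shows "(\<integral>\<^sup>+\<omega>. g \<omega> * indicator (D \<inter> {\<omega>\<in>space M. N k i \<omega> = c}) \<omega> \<partial>M)
    = (\<integral>\<^sup>+\<omega>. g \<omega> * ennreal (pmf (p (\<xi> k \<omega>)) c) * indicator D \<omega> \<partial>M)"
proof -
  \<comment> \<open>Overriding \<open>B\<close> at the fresh index makes the extra condition
    \<open>N k i = c\<close> part of a cylinder.\<close>
  define B' where "B' = B((k, i) := {c})"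
  define D' where "D' = {\<omega>\<in>space M. \<forall>x\<in>insert (k, i) J. N (fst x) (snd x) \<omega> \<in> B' x}"
  have insJ: "finite (insert (k, i) J)" "insert (k, i) J \<subseteq> {(n, i). 1 \<le> i}"
    using J x by auto
  have D': "D \<inter> {\<omega>\<in>space M. N k i \<omega> = c} = D'"
    using x unfolding D D'_def B'_def by auto
  have meas: "D \<in> sets M" "D' \<in> sets M"
    unfolding D D'_def by (rule sets_cylinder J insJ)+
  have "AE \<omega> in M. cprob M env D' \<omega> = (\<Prod>x\<in>insert (k, i) J.
      cprob M env {\<omega>'\<in>space M. N (fst x) (snd x) \<omega>' \<in> B' x} \<omega>)"
    unfolding D'_def by (rule AE_cprob_cylinder[OF insJ])
  moreover have "AE \<omega> in M. cprob M env D \<omega> = (\<Prod>x\<in>J.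
      cprob M env {\<omega>'\<in>space M. N (fst x) (snd x) \<omega>' \<in> B x} \<omega>)"
    unfolding D by (rule AE_cprob_cylinder[OF J])
  moreover have "(\<Prod>x\<in>insert (k, i) J. cprob M env {\<omega>'\<in>space M. N (fst x) (snd x) \<omega>' \<in> B' x} \<omega>)
      = cprob M env {\<omega>'\<in>space M. N k i \<omega>' \<in> {c}} \<omega> *
        (\<Prod>x\<in>J. cprob M env {\<omega>'\<in>space M. N (fst x) (snd x) \<omega>' \<in> B x} \<omega>)" for \<omega>
  proof -
    have "(\<Prod>x\<in>J. cprob M env {\<omega>'\<in>space M. N (fst x) (snd x) \<omega>' \<in> B' x} \<omega>)
      = (\<Prod>x\<in>J. cprob M env {\<omega>'\<in>space M. N (fst x) (snd x) \<omega>' \<in> B x} \<omega>)"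
      using x by (intro prod.cong) (auto simp: B'_def)
    then show ?thesis
      using x J by (simp add: B'_def)
  qed
  moreover have "AE \<omega> in M. cprob M env {\<omega>'\<in>space M. N k i \<omega>' \<in> {c}} \<omega> = pmf (p (\<xi> k \<omega>)) c"
    using offspring_cond_law[OF x(2), of k "{c}"] by (simp add: measure_pmf_single)
  ultimately have "AE \<omega> in M. cprob M env D' \<omega> = pmf (p (\<xi> k \<omega>)) c * cprob M env D \<omega>"
    by (auto elim: eventually_elim2)
  then have "(\<integral>\<^sup>+\<omega>. g \<omega> * ennreal (cprob M env D' \<omega>) \<partial>M)
      = (\<integral>\<^sup>+\<omega>. (g \<omega> * ennreal (pmf (p (\<xi> k \<omega>)) c)) * ennreal (cprob M env D \<omega>) \<partial>M)"
    by (intro nn_integral_cong_AE) (auto simp: ennreal_mult' mult.assoc elim!: eventually_mono)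
  also have "\<dots> = (\<integral>\<^sup>+\<omega>. g \<omega> * ennreal (pmf (p (\<xi> k \<omega>)) c) * indicator D \<omega> \<partial>M)"
    by (intro env.nn_integral_mult_cprob meas) measurable
  finally show ?thesis
    unfolding D' by (subst env.nn_integral_mult_cprob[symmetric]) (auto intro: meas)
qed

text \<open>Split by the value \<open>c\<close> of \<open>N k i\<close>, weight the preceding
  identity by \<open>c\<close> and sum; the series on the right is the offspring mean.\<close>

lemma nn_integral_cylinder_offspring:
  assumes J: "finite J" "J \<subseteq> {(n, i). 1 \<le> i}" and x: "(k, i) \<notin> J" "1 \<le> i"
    and g: "g \<in> borel_measurable env"
    and D: "D = {\<omega>\<in>space M. \<forall>x\<in>J. N (fst x) (snd x) \<omega> \<in> B x}"
  shows "(\<integral>\<^sup>+\<omega>. g \<omega> * of_nat (N k i \<omega>) * indicator D \<omega> \<partial>M)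
    = (\<integral>\<^sup>+\<omega>. g \<omega> * offspring_mean k \<omega> * indicator D \<omega> \<partial>M)"
proof -
  have [measurable]: "D \<in> sets M"
    unfolding D by (rule sets_cylinder J)+
  have [measurable]: "g \<in> borel_measurable M"
    by (rule measurable_from_env[OF g])
  have [measurable]: "N k i \<in> M \<rightarrow>\<^sub>M count_space UNIV"
    by (rule measurable_offspring[OF x(2)])
  have "(\<integral>\<^sup>+\<omega>. g \<omega> * of_nat (N k i \<omega>) * indicator D \<omega> \<partial>M)
    = (\<integral>\<^sup>+\<omega>. (\<Sum>c. of_nat c * (g \<omega> * indicator (D \<inter> {\<omega>\<in>space M. N k i \<omega> = c}) \<omega>)) \<partial>M)"
  proof (rule nn_integral_cong)
    fix \<omega> assume "\<omega> \<in> space M"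
    then have *: "of_nat c * (g \<omega> * indicator (D \<inter> {\<omega>\<in>space M. N k i \<omega> = c}) \<omega>)
      = (g \<omega> * indicator D \<omega>) * (of_nat c * indicator {c} (N k i \<omega>))" for c
      by (auto simp: indicator_def mult.commute)
    then show "g \<omega> * of_nat (N k i \<omega>) * indicator D \<omega>
      = (\<Sum>c. of_nat c * (g \<omega> * indicator (D \<inter> {\<omega>\<in>space M. N k i \<omega> = c}) \<omega>))"
      by (simp only: * ennreal_suminf_cmult suminf_of_nat_indicator) (simp add: mult_ac)
  qed
  also have "\<dots> = (\<Sum>c. of_nat c * (\<integral>\<^sup>+\<omega>. g \<omega> * indicator (D \<inter> {\<omega>\<in>space M. N k i \<omega> = c}) \<omega> \<partial>M))"
    by (subst nn_integral_suminf) (auto simp: nn_integral_cmult)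
  also have "\<dots> = (\<Sum>c. of_nat c * (\<integral>\<^sup>+\<omega>. g \<omega> * ennreal (pmf (p (\<xi> k \<omega>)) c) * indicator D \<omega> \<partial>M))"
    by (simp only: nn_integral_cylinder_eq[OF assms])
  also have "\<dots> = (\<integral>\<^sup>+\<omega>. (\<Sum>c. of_nat c * (g \<omega> * ennreal (pmf (p (\<xi> k \<omega>)) c) * indicator D \<omega>)) \<partial>M)"
    by (subst nn_integral_suminf) (auto simp: nn_integral_cmult)
  also have "\<dots> = (\<integral>\<^sup>+\<omega>. g \<omega> * offspring_mean k \<omega> * indicator D \<omega> \<partial>M)"
  proof (rule nn_integral_cong)
    fix \<omega>
    have *: "of_nat c * (g \<omega> * ennreal (pmf (p (\<xi> k \<omega>)) c) * indicator D \<omega>)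
      = (g \<omega> * indicator D \<omega>) * (of_nat c * ennreal (pmf (p (\<xi> k \<omega>)) c))" for c
      by (simp add: mult_ac)
    then show "(\<Sum>c. of_nat c * (g \<omega> * ennreal (pmf (p (\<xi> k \<omega>)) c) * indicator D \<omega>))
      = g \<omega> * offspring_mean k \<omega> * indicator D \<omega>"
      by (simp only: * ennreal_suminf_cmult law_mean_def) (simp add: mult_ac)
  qed
  finally show ?thesis .
qed

text \<open>Both sides integrate \<open>\<phi>\<close> against the image of a weighted measure under
  \<open>genealogy N k\<close>. These images live on a countable type, so agreement on singletons is
  enough.\<close>

lemma nn_integral_genealogy_offspring:
  fixes \<phi> :: "nat list list \<Rightarrow> ennreal"
  assumes i: "1 \<le> i" and g: "g \<in> borel_measurable env"
  shows "(\<integral>\<^sup>+\<omega>. g \<omega> * of_nat (N k i \<omega>) * \<phi> (genealogy N k \<omega>) \<partial>M)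
    = (\<integral>\<^sup>+\<omega>. g \<omega> * offspring_mean k \<omega> * \<phi> (genealogy N k \<omega>) \<partial>M)"
proof -
  let ?D = "\<lambda>f. distr (density M f) (count_space UNIV) (genealogy N k)"
  have [measurable]: "g \<in> borel_measurable M"
    by (rule measurable_from_env[OF g])
  have [measurable]: "N k i \<in> M \<rightarrow>\<^sub>M count_space UNIV"
    by (rule measurable_offspring[OF i])
  have "?D (\<lambda>\<omega>. g \<omega> * of_nat (N k i \<omega>)) = ?D (\<lambda>\<omega>. g \<omega> * offspring_mean k \<omega>)"
  proof (rule measure_eqI_countable[of _ UNIV])
    fix t
    let ?T = "genealogy N k -` {t} \<inter> space M"
    have [measurable]: "?T \<in> sets M" by measurable
    have "(\<integral>\<^sup>+\<omega>. g \<omega> * of_nat (N k i \<omega>) * indicator ?T \<omega> \<partial>M)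
      = (\<integral>\<^sup>+\<omega>. g \<omega> * offspring_mean k \<omega> * indicator ?T \<omega> \<partial>M)"
    proof (cases "\<exists>\<omega>'\<in>space M. genealogy N k \<omega>' = t")
      case True
      then obtain \<omega>' where t: "t = genealogy N k \<omega>'" by blast
      show ?thesis
        \<comment> \<open>The index set involves generations below \<open>k\<close> only, so
          \<open>(k, i)\<close> is fresh.\<close>
        by (rule nn_integral_cylinder_offspring[OF _ _ _ i g,
              where J = "Sigma {..<k} (\<lambda>j. {1..population N j \<omega>'})"
                and B = "\<lambda>x. {N (fst x) (snd x) \<omega>'}"])
           (auto simp: t genealogy_eq_iff)
    next
      case False
      then have "?T = {}" by auto
      then show ?thesis by simp
    qed
    then show "emeasure (?D (\<lambda>\<omega>. g \<omega> * of_nat (N k i \<omega>))) {t}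
      = emeasure (?D (\<lambda>\<omega>. g \<omega> * offspring_mean k \<omega>)) {t}"
      by (simp add: emeasure_distr emeasure_density)
  qed auto
  then have "(\<integral>\<^sup>+t. \<phi> t \<partial>?D (\<lambda>\<omega>. g \<omega> * of_nat (N k i \<omega>)))
      = (\<integral>\<^sup>+t. \<phi> t \<partial>?D (\<lambda>\<omega>. g \<omega> * offspring_mean k \<omega>))"
    by simp
  then show ?thesis
    by (simp add: nn_integral_distr nn_integral_density)
qed

section \<open>Weighted means of the population size\<close>

text \<open>The next population is the series of \<open>N k i\<close> times the indicator of
  \<open>i \<in> {1..population N k \<omega>}\<close>. That indicator and, since
  \<open>n0 \<le> k\<close>, the factor \<open>f (population N n0 \<omega>)\<close> are functions of
  the genealogy up to \<open>k\<close>, so each term allows \<open>N k i\<close> to be replaced by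
  its conditional mean.\<close>

lemma nn_integral_population_Suc:
  assumes "n0 \<le> k" and g: "g \<in> borel_measurable env"
  shows "(\<integral>\<^sup>+\<omega>. g \<omega> * of_nat (population N (Suc k) \<omega>) * f (population N n0 \<omega>) \<partial>M)
    = (\<integral>\<^sup>+\<omega>. g \<omega> * offspring_mean k \<omega> * of_nat (population N k \<omega>) * f (population N n0 \<omega>) \<partial>M)"
    (is "?L = ?R")
proof -
  have [measurable]: "g \<in> borel_measurable M"
    by (rule measurable_from_env[OF g])
  \<comment> \<open>\<open>1{i \<le> Z\<^sub>k}\<close> and \<open>Z\<^sub>n\<^sub>0\<close> as functions of the genealogy, via an arbitrary preimage\<close>
  define \<phi> :: "nat \<Rightarrow> nat list list \<Rightarrow> ennreal" where
    "\<phi> = (\<lambda>i t. let \<omega> = (SOME \<omega>. genealogy N k \<omega> = t) in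
      f (population N n0 \<omega>) * indicator {1..population N k \<omega>} i)"
  have \<phi>: "\<phi> i (genealogy N k \<omega>) = f (population N n0 \<omega>) * indicator {1..population N k \<omega>} i" for i \<omega>
  proof -
    have "genealogy N k (SOME \<omega>'. genealogy N k \<omega>' = genealogy N k \<omega>) = genealogy N k \<omega>"
      by (rule someI) simp
    from population_eq_if_genealogy_eq[OF this] show ?thesis
      using assms(1) by (simp add: \<phi>_def Let_def)
  qed
  \<comment> \<open>Nothing is assumed about \<open>N k 0\<close>, not even measurability; the
    series may still run over all naturals because its term at 0 vanishes.\<close>
  have 0: "\<phi> 0 (genealogy N k \<omega>) = 0" for \<omega>
    by (simp add: \<phi>)
  have N': "(\<lambda>\<omega>. g \<omega> * of_nat (N k i \<omega>) * \<phi> i (genealogy N k \<omega>)) \<in> borel_measurable M" for i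
  proof (cases "i = 0")
    case False
    then have [measurable]: "N k i \<in> M \<rightarrow>\<^sub>M count_space UNIV"
      by (intro measurable_offspring) auto
    show ?thesis by measurable
  qed (simp add: 0)
  have "?L = (\<integral>\<^sup>+\<omega>. (\<Sum>i. g \<omega> * of_nat (N k i \<omega>) * \<phi> i (genealogy N k \<omega>)) \<partial>M)"
  proof (rule nn_integral_cong)
    fix \<omega>
    have *: "g \<omega> * of_nat (N k i \<omega>) * \<phi> i (genealogy N k \<omega>)
      = (g \<omega> * f (population N n0 \<omega>)) * (of_nat (N k i \<omega>) * indicator {1..population N k \<omega>} i)" for i
      by (simp add: \<phi> mult_ac)
    then show "g \<omega> * of_nat (population N (Suc k) \<omega>) * f (population N n0 \<omega>)
      = (\<Sum>i. g \<omega> * of_nat (N k i \<omega>) * \<phi> i (genealogy N k \<omega>))"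
      by (simp only: * ennreal_suminf_cmult suminf_indicator_atLeastAtMost)
         (simp add: mult_ac del: One_nat_def)
  qed
  also have "\<dots> = (\<Sum>i. \<integral>\<^sup>+\<omega>. g \<omega> * of_nat (N k i \<omega>) * \<phi> i (genealogy N k \<omega>) \<partial>M)"
    by (rule nn_integral_suminf) (rule N')
  also have "\<dots> = (\<Sum>i. \<integral>\<^sup>+\<omega>. g \<omega> * offspring_mean k \<omega> * \<phi> i (genealogy N k \<omega>) \<partial>M)"
  proof (rule suminf_cong)
    fix i
    show "(\<integral>\<^sup>+\<omega>. g \<omega> * of_nat (N k i \<omega>) * \<phi> i (genealogy N k \<omega>) \<partial>M)
      = (\<integral>\<^sup>+\<omega>. g \<omega> * offspring_mean k \<omega> * \<phi> i (genealogy N k \<omega>) \<partial>M)"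
      using nn_integral_genealogy_offspring[OF _ g, of i k "\<phi> i"] by (cases "i = 0") (auto simp: 0)
  qed
  also have "\<dots> = (\<integral>\<^sup>+\<omega>. (\<Sum>i. g \<omega> * offspring_mean k \<omega> * \<phi> i (genealogy N k \<omega>)) \<partial>M)"
    by (rule nn_integral_suminf[symmetric]) measurable
  also have "\<dots> = ?R"
  proof (rule nn_integral_cong)
    fix \<omega>
    have *: "g \<omega> * offspring_mean k \<omega> * \<phi> i (genealogy N k \<omega>)
      = (g \<omega> * offspring_mean k \<omega> * f (population N n0 \<omega>)) * indicator {1..population N k \<omega>} i" for i
      by (simp add: \<phi> mult_ac)
    then show "(\<Sum>i. g \<omega> * offspring_mean k \<omega> * \<phi> i (genealogy N k \<omega>))
      = g \<omega> * offspring_mean k \<omega> * of_nat (population N k \<omega>) * f (population N n0 \<omega>)"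
      \<comment> \<open>All individuals contribute the same mean, so only their number
        remains.\<close>
      using suminf_indicator_atLeastAtMost[of "\<lambda>_. 1" "population N k \<omega>"]
      by (simp only: * ennreal_suminf_cmult mult_1) (simp add: mult_ac del: One_nat_def)
  qed
  finally show ?thesis .
qed

text \<open>The last generation is peeled off and its mean, being \<open>env\<close>-measurable, is
  absorbed into the weight; hence the induction over arbitrary \<open>g\<close>.\<close>

lemma nn_integral_population_add:
  assumes "g \<in> borel_measurable env"
  shows "(\<integral>\<^sup>+\<omega>. g \<omega> * of_nat (population N (n0 + n) \<omega>) * f (population N n0 \<omega>) \<partial>M)
    = (\<integral>\<^sup>+\<omega>. g \<omega> * (\<Prod>k\<in>{n0..<n0 + n}. offspring_mean k \<omega>) *
        of_nat (population N n0 \<omega>) * f (population N n0 \<omega>) \<partial>M)"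
  using assms
proof (induction n arbitrary: g)
  case (Suc n)
  have "(\<lambda>\<omega>. g \<omega> * offspring_mean (n0 + n) \<omega>) \<in> borel_measurable env"
    using Suc.prems measurable_offspring_mean_env[of "n0 + n"] by measurable
  from Suc.IH[OF this] nn_integral_population_Suc[OF le_add1 Suc.prems, of n0 n f]
  show ?case
    by (simp add: mult_ac del: population.simps)
qed simp

text \<open>Inequality rather than equality because \<open>x * inverse x\<close> vanishes for \<open>x \<in> {0, \<infinity>}\<close> in \<^typ>\<open>ennreal\<close>.\<close>

lemma nn_integral_normalized_population_le:
  "(\<integral>\<^sup>+\<omega>. of_nat (population N (n0 + n) \<omega>) *
      inverse ((\<Prod>k\<in>{n0..<n0 + n}. offspring_mean k \<omega>)) * inverse (of_nat (population N n0 \<omega>)) \<partial>M) \<le> 1"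
proof -
  let ?P = "\<lambda>\<omega>. \<Prod>k\<in>{n0..<n0 + n}. offspring_mean k \<omega>"
  have le: "inverse x * x \<le> 1" for x :: ennreal
    by (cases x; cases "x = 0") (auto simp: inverse_ennreal ennreal_mult[symmetric] field_simps)
  have "(\<integral>\<^sup>+\<omega>. of_nat (population N (n0 + n) \<omega>) * inverse (?P \<omega>) * inverse (of_nat (population N n0 \<omega>)) \<partial>M)
    = (\<integral>\<^sup>+\<omega>. inverse (?P \<omega>) * of_nat (population N (n0 + n) \<omega>) * inverse (of_nat (population N n0 \<omega>)) \<partial>M)"
    by (simp add: mult.commute)
  also have "\<dots> = (\<integral>\<^sup>+\<omega>. inverse (?P \<omega>) * ?P \<omega> * of_nat (population N n0 \<omega>) *
      inverse (of_nat (population N n0 \<omega>)) \<partial>M)"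
    \<comment> \<open>The weight \<open>g\<close> is the inverse of the product of means, which
      depends on the environment alone, and \<open>f\<close> is the inverse of the initial
      size.\<close>
    by (intro nn_integral_population_add) measurable
  also have "\<dots> \<le> (\<integral>\<^sup>+\<omega>. 1 \<partial>M)"
  proof (rule nn_integral_mono)
    fix \<omega>
    have "(inverse (?P \<omega>) * ?P \<omega>) * (inverse (of_nat (population N n0 \<omega>)) * of_nat (population N n0 \<omega>)) \<le> 1 * 1"
      by (intro mult_mono le) auto
    then show "inverse (?P \<omega>) * ?P \<omega> * of_nat (population N n0 \<omega>) * inverse (of_nat (population N n0 \<omega>)) \<le> 1"
      by (simp add: mult_ac)
  qed
  also have "\<dots> = 1"
    by (simp add: emeasure_space_1)
  finally show ?thesis .
qed

section \<open>Almost sure positivity and finiteness\<close>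

text \<open>Childlessness has conditional probability 0, hence probability 0 after integration,
  simultaneously for the countably many pairs \<open>(k, i)\<close> with \<open>1 \<le> i\<close>.
  Individual 1 of each generation then keeps the population alive.\<close>

lemma AE_population_pos:
  assumes "AE \<omega> in M. pmf (p (\<xi> 0 \<omega>)) 0 = 0"
  shows "AE \<omega> in M. \<forall>k. 0 < population N k \<omega>"
proof -
  have "AE \<omega> in M. 1 \<le> i \<longrightarrow> N k i \<omega> \<noteq> 0" for k i
  proof (cases "1 \<le> i")
    case True
    let ?A = "{\<omega>\<in>space M. N k i \<omega> \<in> {0}}"
    have A: "?A \<in> sets M"
      using measurable_sets[OF measurable_offspring[OF True], of "{0}" k]
      by (simp add: vimage_def Int_def conj_commute)
    have "AE \<omega> in M. pmf (p (\<xi> k \<omega>)) 0 = 0"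
      by (rule AE_environment_shift[OF _ assms]) measurable
    with offspring_cond_law[OF True, of k "{0}"] have "AE \<omega> in M. cprob M env ?A \<omega> = 0"
      by (auto simp: measure_pmf_single elim: eventually_elim2)
    then have "(\<integral>\<^sup>+\<omega>. 1 * ennreal (cprob M env ?A \<omega>) \<partial>M) = (\<integral>\<^sup>+\<omega>. 0 \<partial>M)"
      by (intro nn_integral_cong_AE) (auto elim: eventually_mono)
    then have "(\<integral>\<^sup>+\<omega>. 1 * indicator ?A \<omega> \<partial>M) = 0"
      by (subst (asm) env.nn_integral_mult_cprob[OF A]) auto
    then have "emeasure M ?A = 0"
      using A by (simp only: mult_1 nn_integral_indicator)
    then show ?thesis
      using A by (intro AE_I[of _ _ ?A]) auto
  qed simp
  then have "AE \<omega> in M. \<forall>k i. 1 \<le> i \<longrightarrow> N k i \<omega> \<noteq> 0"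
    by (simp add: AE_all_countable)
  then show ?thesis
  proof eventually_elim
    case (elim \<omega>)
    have "0 < population N k \<omega>" for k
    proof (induction k)
      case (Suc k)
      have "0 < N k 1 \<omega>" using elim by auto
      also have "\<dots> \<le> (\<Sum>i = 1..population N k \<omega>. N k i \<omega>)"
        using Suc by (intro member_le_sum) auto
      finally show ?case by simp
    qed simp
    then show ?case ..
  qed
qed

lemma AE_law_mean_bounds:
  assumes "standing_assumption M \<xi> p"
  shows "AE \<omega> in M. \<forall>k. 1 \<le> offspring_mean k \<omega> \<and> offspring_mean k \<omega> < \<infinity>"
proof -
  have "AE \<omega> in M. pmf (p (\<xi> 0 \<omega>)) 0 = 0" "AE \<omega> in M. offspring_mean 0 \<omega> < \<infinity>"
    using assms by (auto simp: standing_assumption_def)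
  then have 0: "AE \<omega> in M. 1 \<le> offspring_mean 0 \<omega> \<and> offspring_mean 0 \<omega> < \<infinity>"
    by eventually_elim (simp add: one_le_law_mean)
  have "AE \<omega> in M. 1 \<le> offspring_mean k \<omega> \<and> offspring_mean k \<omega> < \<infinity>" for k
    by (rule AE_environment_shift[where P = "\<lambda>e. 1 \<le> law_mean (p e) \<and> law_mean (p e) < \<infinity>", OF _ 0])
      measurable
  then show ?thesis by (simp add: AE_all_countable)
qed

lemma measurable_log_mean [measurable]: "log_mean \<xi> p k \<in> borel_measurable M"
  unfolding log_mean_def by measurable

section \<open>The two tail bounds and the decomposition of the population ratio\<close>

lemma log_mean_Hoeffding:
  assumes "H1 < H2" and bounds: "AE \<omega> in M. H1 \<le> log_mean \<xi> p 0 \<omega> - env_mu M \<xi> p \<and>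
      log_mean \<xi> p 0 \<omega> - env_mu M \<xi> p \<le> H2"
    and "1 \<le> n" "0 \<le> \<epsilon>"
  shows "prob {\<omega>\<in>space M. (\<Sum>k\<in>{n0..<n0 + n}. log_mean \<xi> p k \<omega>) \<ge> real n * env_mu M \<xi> p + \<epsilon>}
    \<le> exp (- 2 * \<epsilon>\<^sup>2 / (real n * (H2 - H1)\<^sup>2))"
proof -
  define h where "h = (\<lambda>e. ln (enn2real (law_mean (p e))))"
  have [measurable]: "h \<in> borel_measurable E"
    unfolding h_def by measurable
  have h: "log_mean \<xi> p k = (\<lambda>\<omega>. h (\<xi> k \<omega>))" for k
    by (simp add: log_mean_def h_def fun_eq_iff)
  \<comment> \<open>The hypothesis bounds the centred variable, so both endpoints are shifted by the
    mean; the length of the interval is still \<open>H2 - H1\<close>.\<close>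
  interpret Hoeffding_ineq_iid M "{n0..<n0 + n}" "log_mean \<xi> p" "log_mean \<xi> p 0"
    "H1 + env_mu M \<xi> p" "H2 + env_mu M \<xi> p" "env_mu M \<xi> p"
  proof unfold_locales
    show "indep_vars (\<lambda>_. borel) (log_mean \<xi> p) {n0..<n0 + n}"
      unfolding h by (rule indep_vars_compose2[OF indep_vars_subset[OF env_indep]]) auto
    show "distr M borel (log_mean \<xi> p i) = distr M borel (log_mean \<xi> p 0)" for i
    proof -
      have "distr M borel (log_mean \<xi> p k) = distr (distr M E (\<xi> k)) borel h" for k
        by (subst distr_distr) (auto simp: h comp_def)
      then show ?thesis using env_ident[of i] by metis
    qed
    show "AE x in M. log_mean \<xi> p 0 x \<in> {H1 + env_mu M \<xi> p..H2 + env_mu M \<xi> p}"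
      using bounds by eventually_elim auto
  qed (auto simp: env_mu_def)
  show ?thesis
    using X.Hoeffding_ineq_ge[of \<epsilon>] assms by simp
qed

text \<open>Markov's inequality at level \<open>exp \<epsilon>\<close> for a variable of mean at
  most 1. The event is written with the factor \<open>exp (- \<epsilon>)\<close> to avoid a division
  in \<open>ennreal\<close>.\<close>

lemma normalized_population_Markov:
  "prob {\<omega>\<in>space M. 1 \<le> ennreal (exp (- \<epsilon>)) * (of_nat (population N (n0 + n) \<omega>) *
      inverse (\<Prod>k\<in>{n0..<n0 + n}. offspring_mean k \<omega>) * inverse (of_nat (population N n0 \<omega>)))}
    \<le> exp (- \<epsilon>)"
proof -
  let ?W = "\<lambda>\<omega>. of_nat (population N (n0 + n) \<omega>) *
      inverse (\<Prod>k\<in>{n0..<n0 + n}. offspring_mean k \<omega>) * inverse (of_nat (population N n0 \<omega>)) :: ennreal"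
  have "emeasure M {\<omega>\<in>space M. 1 \<le> ennreal (exp (- \<epsilon>)) * ?W \<omega>} \<le> ennreal (exp (- \<epsilon>)) * (\<integral>\<^sup>+\<omega>. ?W \<omega> * indicator (space M) \<omega> \<partial>M)"
    by (rule nn_integral_Markov_inequality) measurable
  also have "(\<integral>\<^sup>+\<omega>. ?W \<omega> * indicator (space M) \<omega> \<partial>M) = (\<integral>\<^sup>+\<omega>. ?W \<omega> \<partial>M)"
    by (intro nn_integral_cong) auto
  also have "ennreal (exp (- \<epsilon>)) * \<dots> \<le> ennreal (exp (- \<epsilon>)) * 1"
    by (intro mult_left_mono nn_integral_normalized_population_le) auto
  finally show ?thesis
    by (simp add: emeasure_eq_measure)
qed

text \<open>The logarithm of the ratio is the sum of the \<open>log_mean\<close> terms plus the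
  logarithm of the normalized population. If the total exceeds \<open>c + 2 * \<epsilon>\<close>,
  the first summand is at least \<open>c + \<epsilon>\<close> or the second at least
  \<epsilon>.\<close>

lemma AE_log_population_ratio_cases:
  assumes "standing_assumption M \<xi> p"
  shows "AE \<omega> in M. c + 2 * \<epsilon> < ln (real (population N (n0 + n) \<omega>) / real (population N n0 \<omega>)) \<longrightarrow>
    c + \<epsilon> \<le> (\<Sum>k\<in>{n0..<n0 + n}. log_mean \<xi> p k \<omega>) \<or>
    1 \<le> ennreal (exp (- \<epsilon>)) * (of_nat (population N (n0 + n) \<omega>) *
      inverse (\<Prod>k\<in>{n0..<n0 + n}. offspring_mean k \<omega>) * inverse (of_nat (population N n0 \<omega>)))"
proof -
  have "AE \<omega> in M. \<forall>k. 0 < population N k \<omega>"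
    using assms by (intro AE_population_pos) (simp add: standing_assumption_def)
  with AE_law_mean_bounds[OF assms] show ?thesis
  proof eventually_elim
    case (elim \<omega>)
    \<comment> \<open>Outside a null set all means and sizes are finite and positive, so the
      \<open>ennreal\<close> expression is the image of a positive real and real logarithms
      apply.\<close>
    define r where "r k = enn2real (offspring_mean k \<omega>)" for k
    define R where "R = (\<Prod>k\<in>{n0..<n0 + n}. r k)"
    define z where "z = real (population N n0 \<omega>)"
    define z' where "z' = real (population N (n0 + n) \<omega>)"
    have m: "offspring_mean k \<omega> = ennreal (r k)" for k
      using elim(1) by (simp add: r_def ennreal_enn2real)
    have r: "0 < r k" for k
    proof -
      have "1 \<le> ennreal (r k)" using elim(1) m by metis
      then show ?thesis by (cases "0 < r k") (auto simp: ennreal_neg not_less)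
    qed
    have pos: "0 < R" "0 < z" "0 < z'"
      using r elim(2) by (auto simp: R_def z_def z'_def intro: prod_pos)
    have lnR: "(\<Sum>k\<in>{n0..<n0 + n}. log_mean \<xi> p k \<omega>) = ln R"
      using r unfolding R_def log_mean_def r_def by (subst ln_prod) (auto simp: less_imp_neq[THEN not_sym])
    have "(\<Prod>k\<in>{n0..<n0 + n}. offspring_mean k \<omega>) = ennreal R"
      using r unfolding R_def m by (intro prod_ennreal) (auto simp: less_imp_le)
    moreover have "of_nat (population N n0 \<omega>) = ennreal z" "of_nat (population N (n0 + n) \<omega>) = ennreal z'"
      by (simp_all add: z_def z'_def ennreal_of_nat_eq_real_of_nat)
    ultimately have W: "ennreal (exp (- \<epsilon>)) * (of_nat (population N (n0 + n) \<omega>) *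
        inverse (\<Prod>k\<in>{n0..<n0 + n}. offspring_mean k \<omega>) * inverse (of_nat (population N n0 \<omega>)))
      = ennreal (exp (- \<epsilon>) * (z' * inverse R * inverse z))"
      using pos by (simp add: inverse_ennreal ennreal_mult[symmetric])
    have "1 \<le> exp (- \<epsilon>) * (z' * inverse R * inverse z)"
      if "c + 2 * \<epsilon> < ln (z' / z)" "ln R < c + \<epsilon>"
    proof -
      have "0 \<le> ln (exp (- \<epsilon>) * (z' * inverse R * inverse z))"
        using that pos by (simp add: ln_mult ln_div ln_inverse)
      then show ?thesis
        using pos by (subst (asm) ln_ge_zero_iff) auto
    qed
    then show ?case
      unfolding lnR W z_def[symmetric] z'_def[symmetric] by (cases "ln R < c + \<epsilon>") auto
  qed
qed

end

section \<open>Calibration of the confidence radius\<close>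

text \<open>With \<open>L = ln (2 / \<delta>)\<close> and \<open>a = sqrt (2 / real n * L)\<close>
  the radius is \<open>H * a\<close>. The Hoeffding exponent is
  \<open>n * a\<^sup>2 / 2 = L\<close>, which gives equality. The lower bound on \<delta> says
  \<open>L \<le> n * H\<^sup>2 / 2\<close>, that is \<open>a \<le> H\<close>, so the Markov exponent
  \<open>n * H * a / 2\<close> is at least \<open>n * a\<^sup>2 / 2 = L\<close>.\<close>

lemma confidence_radius_bounds:
  fixes H \<delta> \<Delta> :: real
  assumes n: "1 \<le> n" and H: "0 < H" and \<delta>: "\<delta> \<in> {2 * exp (- (real n / 2 * H\<^sup>2)) .. 1}"
    and \<Delta>: "\<Delta> = H * sqrt (2 / real n * ln (2 / \<delta>))"
  shows "0 \<le> \<Delta>"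
    and "exp (- 2 * (real n * \<Delta> / 2)\<^sup>2 / (real n * H\<^sup>2)) = \<delta> / 2"
    and "exp (- (real n * \<Delta> / 2)) \<le> \<delta> / 2"
proof -
  define L where "L = ln (2 / \<delta>)"
  define a where "a = sqrt (2 / real n * L)"
  have "0 < 2 * exp (- (real n / 2 * H\<^sup>2))" by simp
  then have \<delta>0: "0 < \<delta>" using \<delta> by (meson atLeastAtMost_iff less_le_trans)
  \<comment> \<open>Here the bound \<open>\<delta> \<le> 1\<close> enters, through
    \<open>2 / \<delta> \<ge> 1\<close>.\<close>
  have L: "0 \<le> L" using \<delta> \<delta>0 unfolding L_def by (intro ln_ge_zero) auto
  have expL: "exp (- L) = \<delta> / 2"
    using \<delta>0 by (simp add: L_def exp_minus)
  have "2 * exp (- (real n / 2 * H\<^sup>2)) \<le> \<delta>"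
    using \<delta> by (simp only: atLeastAtMost_iff)
  then have "exp (- (real n / 2 * H\<^sup>2)) \<le> exp (- L)"
    unfolding expL by linarith
  then have L_le: "L \<le> real n / 2 * H\<^sup>2" by (simp only: exp_le_cancel_iff neg_le_iff_le)
  have a0: "0 \<le> a" using L n by (simp add: a_def)
  have a2: "real n * a\<^sup>2 = 2 * L" using L n by (simp add: a_def)
  have "real n * a\<^sup>2 \<le> real n * H\<^sup>2" using a2 L_le by linarith
  then have "a\<^sup>2 \<le> H\<^sup>2" using n by simp
  then have aH: "a \<le> H" by (rule power2_le_imp_le) (use H in simp)
  have \<Delta>: "\<Delta> = H * a" by (simp add: \<Delta> a_def L_def)
  show "0 \<le> \<Delta>" using \<Delta> a0 H by simp
  have "2 * (real n * \<Delta> / 2)\<^sup>2 / (real n * H\<^sup>2) = real n * a\<^sup>2 / 2"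
    using n H by (simp add: \<Delta> power2_eq_square field_simps)
  then show "exp (- 2 * (real n * \<Delta> / 2)\<^sup>2 / (real n * H\<^sup>2)) = \<delta> / 2"
    using a2 expL by simp
  have "a * a \<le> H * a" using aH a0 by (rule mult_right_mono)
  then have "real n * a\<^sup>2 \<le> real n * \<Delta>"
    using n by (simp add: \<Delta> power2_eq_square)
  then have "exp (- (real n * \<Delta> / 2)) \<le> exp (- L)" unfolding exp_le_cancel_iff using a2 by linarith
  then show "exp (- (real n * \<Delta> / 2)) \<le> \<delta> / 2" using expL by simp
qed

section \<open>Union bound over the two ways of missing the mean\<close>

theorem proposition3p2:
  fixes M :: "'a measure"
    and E :: "'e measure"
    and \<xi> :: "nat \<Rightarrow> 'a \<Rightarrow> 'e"
    and p :: "'e \<Rightarrow> nat pmf"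
    and N :: "nat \<Rightarrow> nat \<Rightarrow> 'a \<Rightarrow> nat"
    and H1 H2 \<delta> \<Delta> :: real
    and n0 n :: nat
    and A :: "'a \<Rightarrow> real"
  assumes "branching_random_env M E \<xi> p N"
    and "standing_assumption M \<xi> p"
    and "H1 < H2"
    and "AE \<omega> in M. H1 \<le> log_mean \<xi> p 0 \<omega> - env_mu M \<xi> p \<and>
                    log_mean \<xi> p 0 \<omega> - env_mu M \<xi> p \<le> H2"
    and "1 \<le> n"
    and "\<delta> \<in> {2 * exp (- (real n / 2 * (H2 - H1)\<^sup>2)) .. 1}"
    and "\<Delta> = (H2 - H1) * sqrt (2 / real n * ln (2 / \<delta>))"
    and "\<And>\<omega>. A \<omega> = 1 / real n * ln (real (population N (n0 + n) \<omega>) / real (population N n0 \<omega>)) - \<Delta>"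
  shows "measure M {\<omega> \<in> space M. env_mu M \<xi> p \<in> {A \<omega> ..}} \<ge> 1 - \<delta>"
proof -
  interpret branching_random_env M E \<xi> p N by (rule assms(1))
  define \<mu> where "\<mu> = env_mu M \<xi> p"
  \<comment> \<open>The excess \<open>n * \<Delta>\<close> is shared equally between the environment
    and the normalized population.\<close>
  define \<epsilon> where "\<epsilon> = real n * \<Delta> / 2"
  have H: "0 < H2 - H1" using assms(3) by simp
  note radius = confidence_radius_bounds[OF assms(5) H assms(6,7)]
  have \<epsilon>: "0 \<le> \<epsilon>" using radius(1) by (simp add: \<epsilon>_def)
  define U where "U = {\<omega>\<in>space M. (\<Sum>k\<in>{n0..<n0 + n}. log_mean \<xi> p k \<omega>) \<ge> real n * \<mu> + \<epsilon>}"
  define V where "V = {\<omega>\<in>space M. 1 \<le> ennreal (exp (- \<epsilon>)) * (of_nat (population N (n0 + n) \<omega>) *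
      inverse (\<Prod>k\<in>{n0..<n0 + n}. offspring_mean k \<omega>) * inverse (of_nat (population N n0 \<omega>)))}"
  define good where "good = {\<omega> \<in> space M. \<mu> \<in> {A \<omega> ..}}"
  have [measurable]: "A \<in> borel_measurable M"
    unfolding assms(8)[abs_def] by measurable
  have sets [measurable]: "U \<in> sets M" "V \<in> sets M" "good \<in> sets M"
    unfolding U_def V_def good_def by simp_all
  \<comment> \<open>The inclusion holds only almost surely, since the decomposition of the logarithm
    requires positive sizes and finite means.\<close>
  have "prob (space M - good) \<le> prob (U \<union> V)"
  proof (rule finite_measure_mono_AE)
    show "AE \<omega> in M. \<omega> \<in> space M - good \<longrightarrow> \<omega> \<in> U \<union> V"
      using AE_log_population_ratio_cases[OF assms(2), of "real n * \<mu>" \<epsilon> n0 n]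
    proof eventually_elim
      case (elim \<omega>)
      have "real n * \<mu> + 2 * \<epsilon> < ln (real (population N (n0 + n) \<omega>) / real (population N n0 \<omega>))"
        if "\<mu> < A \<omega>"
        using that assms(5) by (simp add: assms(8) \<epsilon>_def field_simps)
      with elim show ?case
        by (auto simp: U_def V_def good_def)
    qed
  qed simp
  also have "\<dots> \<le> prob U + prob V"
    by (rule measure_Un_le) simp_all
  also have "prob U \<le> \<delta> / 2"
    using log_mean_Hoeffding[OF assms(3,4,5) \<epsilon>, of n0] radius(2)
    by (simp add: U_def \<mu>_def \<epsilon>_def)
  also have "prob V \<le> \<delta> / 2"
    using normalized_population_Markov[of \<epsilon> n0 n] radius(3)
    by (simp add: V_def \<epsilon>_def)
  finally show ?thesis
    by (simp add: prob_compl good_def \<mu>_def[symmetric])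
qed

end
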